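(* Let $\ell\ge2$, $d\ge1$ and $e=d\ell$. For any $\sigma\in\mathbb Z$, let $\mathsf z^\ell_{d,\sigma}(q)=\sum q^{\mathrm{rk}(|\boldsymbol\lambda,\boldsymbol\sigma\rangle)}$, summed over all charged $\ell$-partitions $|\boldsymbol\lambda,\boldsymbol\sigma\rangle$ with $\sigma_1+\dots+\sigma_\ell=\sigma$ that are spetsial $d$-cores. Then $$\mathsf z^\ell_{d,\sigma}(q)=\sum_{\boldsymbol s}q^{\widetilde{\mathrm{rk}}(\boldsymbol s)}\,\mathsf c_{e,\boldsymbol s}(q),$$ where $\boldsymbol s$ runs over all $(s_1,\dots,s_\ell)\in\mathbb Z^\ell$ with $s_1\le s_2\le\dots\le s_\ell\le s_1+e$ and $s_1+\dots+s_\ell=\sigma+d\,\frac{\ell(\ell-1)}2$.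
   Context: A partition $\lambda=(\lambda_1\ge\lambda_2\ge\cdots)$ is a weakly decreasing sequence of natural numbers with finitely many nonzero terms; $|\lambda|=\sum_i\lambda_i$. An $\ell$-partition is an $\ell$-tuple $\boldsymbol\lambda=(\lambda^1,\dots,\lambda^\ell)$ of partitions; $|\boldsymbol\lambda|=\sum_j|\lambda^j|$. A charged $\ell$-partition $|\boldsymbol\lambda,\boldsymbol s\rangle$ is a pair of an $\ell$-partition and a charge $\boldsymbol s\in\mathbb Z^\ell$; its symbol (or abacus) is $(S^{(1)},\dots,S^{(\ell)})$ with $S^{(j)}=\{\lambda^j_k-k+1+s_j : k\ge1\}\subset\mathbb Z$, identified with the subset $\{(\beta,j):\beta\in S^{(j)}\}$ of $\mathbb Z\times\{1,\dots,\ell\}$. Spetsial $d$-core: a charged $\ell$-partition such that whenever $\beta\in S^{(j)}$ one has $\beta-d\in S^{(j+1)}$ (superscripts mod $\ell$). $(e,\boldsymbol s)$-cores: level-rank duality LR maps charged $\ell$-partitions to charged $e$-partitions, being induced on abaci by the bijection $\mathbb Z\times\{1,\dots,\ell\}\to\mathbb Z\times\{1,\dots,e\}$, $(k,j)\mapsto\left(\ell(\lfloor\frac{k-1}{e}\rfloor+1)-j+1,\ ((k-1)\bmod e)+1\right)$. An $\ell$-partition $\boldsymbol\lambda$ is an $(e,\boldsymbol s)$-core if $\mathrm{LR}(|\boldsymbol\lambda,\boldsymbol s\rangle)$ has empty underlying $e$-partition; equivalently $S^{(1)}\subseteq S^{(2)}\subseteq\dots\subseteq S^{(\ell)}\subseteq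 S^{(1)}+e$. $\mathsf c_{e,\boldsymbol s}(q)=\sum q^{|\boldsymbol\lambda|}$, summed over all $(e,\boldsymbol s)$-cores $\boldsymbol\lambda$. Rank of a charged $\ell$-partition with symbol $(S^{(1)},\dots,S^{(\ell)})$: let $m=\max\{z\in\mathbb Z : z\notin S^{(j)}\text{ for some }j\}$, let $c$ be the number of pairs $(\beta,j)$ with $\beta\in S^{(j)}$, $\beta\ge m$; then $\mathrm{rk}=\sum_{j}\sum_{\beta\in S^{(j)},\beta\ge m}\beta-cm-\left\lfloor\frac{(c-1)(c-\ell+1)}{2\ell}\right\rfloor$. Rank of a charge $\boldsymbol\sigma\in\mathbb Z^\ell$: $\mathrm{rk}(\boldsymbol\sigma)=\left\lceil\frac{Y-\ell+1}{2\ell}\right\rceil$, $Y=\sum_{i}\sum_{j\ne i}\sigma_i(\sigma_i-\sigma_j)$. Finally $\widetilde{\mathrm{rk}}(\boldsymbol s)=\mathrm{rk}(\boldsymbol s-d\boldsymbol\rho)$ with $\boldsymbol\rho=(0,1,\dots,\ell-1)$.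
   Formalization: In the rank of a charged ℓ-partition, m is taken as the minimum, not the maximum, of the integers z missing from some S^(j): each S^(j) is bounded above, so that maximum never exists. *)

theory Defs
  imports
    "HOL-Analysis.Infinite_Sum"
    "HOL-Computational_Algebra.Formal_Laurent_Series"
begin

text \<open>
  A partition \<open>\<lambda>\<^sub>1 \<ge> \<lambda>\<^sub>2 \<ge> \<dots>\<close> is a function \<open>p\<close> on the naturals with \<open>p i = \<lambda>\<^sub>i\<^sub>+\<^sub>1\<close>.
  An \<open>l\<close>-tuple is a list of length \<open>l\<close>.  Runners of the abacus keep the indices
  \<open>1, \<dots>, l\<close>, so that runner \<open>j\<close> belongs to the list entries at position \<open>j - 1\<close>.
\<close>

definition is_partition :: "(nat \<Rightarrow> nat) \<Rightarrow> bool" where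
  "is_partition p \<longleftrightarrow> decseq p \<and> finite {i. p i \<noteq> 0}"

definition partition_size :: "(nat \<Rightarrow> nat) \<Rightarrow> nat" where
  "partition_size p = (\<Sum>i | p i \<noteq> 0. p i)"

definition is_multipartition :: "nat \<Rightarrow> (nat \<Rightarrow> nat) list \<Rightarrow> bool" where
  "is_multipartition l lam \<longleftrightarrow> length lam = l \<and> (\<forall>p\<in>set lam. is_partition p)"

definition multipartition_size :: "(nat \<Rightarrow> nat) list \<Rightarrow> nat" where
  "multipartition_size lam = sum_list (map partition_size lam)"

definition empty_multipartition :: "nat \<Rightarrow> (nat \<Rightarrow> nat) list" where
  "empty_multipartition l = replicate l (\<lambda>_. 0)"

type_synonym charged_multipartition = "(nat \<Rightarrow> nat) list \<times> int list"

definition is_charged_multipartition :: "nat \<Rightarrow> charged_multipartition \<Rightarrow> bool" where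
  "is_charged_multipartition l x \<longleftrightarrow> is_multipartition l (fst x) \<and> length (snd x) = l"

text \<open>With \<open>i = k - 1\<close>, the beta-number \<open>\<lambda>\<^sup>j\<^sub>k - k + 1 + s\<^sub>j\<close> becomes \<open>\<lambda>\<^sup>j\<^sub>i\<^sub>+\<^sub>1 - i + s\<^sub>j\<close>.\<close>

definition runner :: "charged_multipartition \<Rightarrow> nat \<Rightarrow> int set" where
  "runner x j = {int ((fst x ! (j - 1)) i) - int i + snd x ! (j - 1) | i. True}"

definition abacus :: "charged_multipartition \<Rightarrow> (int \<times> nat) set" where
  "abacus x = {(\<beta>, j). 1 \<le> j \<and> j \<le> length (snd x) \<and> \<beta> \<in> runner x j}"

definition spetsial_core :: "nat \<Rightarrow> charged_multipartition \<Rightarrow> bool" where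
  "spetsial_core d x \<longleftrightarrow>
     (let l = length (snd x) in
      \<forall>j\<in>{1..l}. \<forall>\<beta>\<in>runner x j. \<beta> - int d \<in> runner x (if j = l then 1 else j + 1))"

definition level_rank_map :: "nat \<Rightarrow> nat \<Rightarrow> int \<times> nat \<Rightarrow> int \<times> nat" where
  "level_rank_map l e = (\<lambda>(k, j).
     (int l * ((k - 1) div int e + 1) - int j + 1, nat ((k - 1) mod int e) + 1))"

definition level_rank :: "nat \<Rightarrow> charged_multipartition \<Rightarrow> charged_multipartition" where
  "level_rank e x =
     (THE y. is_charged_multipartition e y \<and>
             abacus y = level_rank_map (length (snd x)) e ` abacus x)"

definition es_core :: "nat \<Rightarrow> int list \<Rightarrow> (nat \<Rightarrow> nat) list \<Rightarrow> bool" where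
  "es_core e s lam \<longleftrightarrow>
     is_multipartition (length s) lam \<and> fst (level_rank e (lam, s)) = empty_multipartition e"

text \<open>
  Every runner is bounded above and contains all sufficiently small integers.  The
  reference point \<open>m\<close> is the smallest integer missing from some runner; everything
  below \<open>m\<close> lies on all runners, so only finitely many beads are \<open>\<ge> m\<close>.  (There is
  no largest missing integer.)
\<close>

definition charged_rank :: "charged_multipartition \<Rightarrow> int" where
  "charged_rank x =
     (let l = length (snd x);
          m = (LEAST z. \<exists>j\<in>{1..l}. z \<notin> runner x j);
          c = int (card {(\<beta>, j). (\<beta>, j) \<in> abacus x \<and> \<beta> \<ge> m})
      in (\<Sum>j = 1..l. \<Sum>\<beta> | \<beta> \<in> runner x j \<and> \<beta> \<ge> m. \<beta>) - c * m
         - \<lfloor>real_of_int ((c - 1) * (c - int l + 1)) / real_of_int (2 * int l)\<rfloor>)"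

definition charge_rank :: "int list \<Rightarrow> int" where
  "charge_rank t =
     (let l = length t;
          Y = (\<Sum>i<l. \<Sum>j\<in>{..<l} - {i}. t ! i * (t ! i - t ! j))
      in \<lceil>real_of_int (Y - int l + 1) / real_of_int (2 * int l)\<rceil>)"

definition charge_rank_tilde :: "nat \<Rightarrow> int list \<Rightarrow> int" where
  "charge_rank_tilde d s =
     charge_rank (map (\<lambda>j. s ! j - int d * int j) [0..<length s])"

text \<open>
  The generating functions are formal Laurent series in \<open>q\<close>, so that \<open>q\<^sup>n\<close> makes sense for
  every integer exponent \<open>n\<close> without truncation; infinite sums are taken in the usual
  metric topology on formal Laurent series.
\<close>

definition spetsial_cores :: "nat \<Rightarrow> nat \<Rightarrow> int \<Rightarrow> charged_multipartition set" where
  "spetsial_cores l d \<sigma> =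
     {x. is_charged_multipartition l x \<and> sum_list (snd x) = \<sigma> \<and> spetsial_core d x}"

definition spetsial_gf :: "nat \<Rightarrow> nat \<Rightarrow> int \<Rightarrow> int fls" where
  "spetsial_gf l d \<sigma> = (\<Sum>\<^sub>\<infinity>x\<in>spetsial_cores l d \<sigma>. fls_X_intpow (charged_rank x))"

definition es_core_gf :: "nat \<Rightarrow> int list \<Rightarrow> int fls" where
  "es_core_gf e s = (\<Sum>\<^sub>\<infinity>lam | es_core e s lam. fls_X_intpow (int (multipartition_size lam)))"

definition alcove_charges :: "nat \<Rightarrow> nat \<Rightarrow> int \<Rightarrow> int list set" where
  "alcove_charges l e S =
     {s. length s = l \<and> sorted s \<and> last s \<le> hd s + int e \<and> sum_list s = S}"

end

theory Submission
  imports Defs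
begin

text \<open>
  The identity comes from a weight-preserving bijection.  Raise runner \<open>j\<close> of the abacus of
  a charged multipartition by \<open>d (j - 1)\<close>; this changes the charge \<open>\<sigma>\<close> into
  \<open>s = \<sigma> + d \<rho>\<close> and keeps the partitions.  The spetsial condition
  \<open>S\<^sub>j - d \<subseteq> S\<^sub>j\<^sub>+\<^sub>1\<close> (indices modulo \<open>l\<close>) becomes the chain of inclusions
  \<open>S\<^sub>1 \<subseteq> \<dots> \<subseteq> S\<^sub>l \<subseteq> S\<^sub>1 + d l\<close>.  Under level-rank duality this chain says precisely that
  the dual \<open>e\<close>-partition is empty, so it characterizes the \<open>(e, s)\<close>-cores.  Comparing the
  numbers of beads in the chain gives \<open>s\<^sub>1 \<le> \<dots> \<le> s\<^sub>l \<le> s\<^sub>1 + e\<close>.  Hence spetsial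
  \<open>d\<close>-cores correspond to pairs of a charge \<open>s\<close> in the alcove and an \<open>(e, s)\<close>-core
  (lemmas \<open>es_core_iff_interlacing\<close>, \<open>es_core_iff_spetsial_core\<close> and
  \<open>bij_betw_es_cores_spetsial_cores\<close>).

  The weights agree because the rank of a charged multipartition is the total size of its
  partitions plus the rank of its charge (\<open>charged_rank_eq_size_plus_charge_rank\<close>).  The
  reference point \<open>m\<close> in the definition of the rank lies so low that every nonzero part
  has its bead above \<open>m\<close>; therefore the sum of bead positions sees the full size of the
  partitions, and what remains depends on the numbers of beads only.

  As for the infinite sums, a sum of monomials \<open>q\<^sup>w\<^sup>(\<^sup>x\<^sup>)\<close> converges as soon as only
  finitely many \<open>x\<close> have weight below any given bound, and its coefficients are then the fibre
  cardinalities of \<open>w\<close> (\<open>has_sum_fls_X_intpow\<close>).  There are finitely many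
  multipartitions of bounded size and finitely many charges in the alcove, so the
  identity follows by comparing cardinalities of fibres.
\<close>

section \<open>Infinite sums of monomials in Laurent series\<close>

unbundle fps_syntax

text \<open>
  Coefficientwise agreement up to a high degree means closeness in the metric of Laurent
  series.  This reduces the topological content of the generating functions to counting.
\<close>

lemma dist_fls_less:
  fixes a b :: "'a::group_add fls"
  assumes "\<And>k. k \<le> int N \<Longrightarrow> a $$ k = b $$ k"
  shows "dist a b < inverse (2 ^ N)"
proof (cases "a = b")
  case True
  then show ?thesis by simp
next
  case False
  then have "a - b \<noteq> 0" by simp
  have gt: "fls_subdegree (a - b) > int N"
  proof (rule ccontr)
    assume "\<not> fls_subdegree (a - b) > int N"
    then have "(a - b) $$ fls_subdegree (a - b) = 0"
      using assms by simp
    then show False using nth_fls_subdegree_nonzero[OF \<open>a - b \<noteq> 0\<close>] by blast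
  qed
  then have "(2::real) ^ N < 2 ^ nat (fls_subdegree (a - b))"
    by (intro power_strict_increasing) auto
  with gt False show ?thesis by (simp add: dist_fls_def)
qed

text \<open>
  Finiteness of all sublevel sets of \<open>w\<close> already forces \<open>w\<close> to be bounded below on \<open>A\<close>:
  the finitely many elements of weight at most \<open>0\<close> attain a minimum.  Hence the fibre
  cardinalities really are the coefficients of a Laurent series.
\<close>

lemma nth_Abs_fls_card_fibre:
  fixes w :: "'a \<Rightarrow> int"
  assumes fin: "\<And>n. finite {x \<in> A. w x \<le> n}"
  shows "Abs_fls (\<lambda>n. int (card {x \<in> A. w x = n})) $$ k = int (card {x \<in> A. w x = k})"
proof (rule nth_Abs_fls_lower_bound)
  let ?N = "Min (insert 0 (w ` {x \<in> A. w x \<le> 0}))"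
  have "{x \<in> A. w x = n} = {}" if "n < ?N" for n
    using that fin[of 0] by (auto simp: Min_gr_iff)
  then show "\<forall>n<?N. int (card {x \<in> A. w x = n}) = 0" by (metis card.empty of_nat_0)
qed

text \<open>
  The coefficient at \<open>k\<close> of a partial sum is final as soon as the index set contains all
  elements of weight at most \<open>k\<close>, and there are only finitely many of those.
\<close>

lemma has_sum_fls_X_intpow:
  fixes w :: "'a \<Rightarrow> int"
  assumes fin: "\<And>n. finite {x \<in> A. w x \<le> n}"
  shows "((\<lambda>x. fls_X_intpow (w x) :: int fls) has_sum
           Abs_fls (\<lambda>n. int (card {x \<in> A. w x = n}))) A"
  unfolding has_sum_def tendsto_iff
proof (intro allI impI)
  fix r :: real
  assume "r > 0"
  then obtain N where N: "inverse (2 ^ N) < r"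
    using real_arch_pow_inv[of r "1/2"] by (auto simp: power_one_over field_simps)
  have "dist (\<Sum>x\<in>Y. fls_X_intpow (w x) :: int fls)
             (Abs_fls (\<lambda>n. int (card {x \<in> A. w x = n}))) < r"
    if Y: "finite Y" "{x \<in> A. w x \<le> int N} \<subseteq> Y" "Y \<subseteq> A" for Y
  proof -
    have "(\<Sum>x\<in>Y. fls_X_intpow (w x) :: int fls) $$ k = int (card {x \<in> A. w x = k})"
      if k: "k \<le> int N" for k
    proof -
      have "{x \<in> A. w x = k} = {x \<in> Y. w x = k}" using Y k by auto
      moreover have "(\<Sum>x\<in>Y. fls_X_intpow (w x) :: int fls) $$ k
                       = (\<Sum>x\<in>Y. if w x = k then 1 else 0)"
        by (auto simp: fls_nth_sum intro!: sum.cong)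
      moreover have "\<dots> = int (card {x \<in> Y. w x = k})"
        using Y(1) by (simp add: sum.If_cases Int_def)
      ultimately show ?thesis by simp
    qed
    then have "dist (\<Sum>x\<in>Y. fls_X_intpow (w x) :: int fls)
             (Abs_fls (\<lambda>n. int (card {x \<in> A. w x = n}))) < inverse (2 ^ N)"
      by (intro dist_fls_less) (simp add: nth_Abs_fls_card_fibre[OF fin])
    with N show ?thesis by simp
  qed
  then show "\<forall>\<^sub>F Y in finite_subsets_at_top A.
      dist (\<Sum>x\<in>Y. fls_X_intpow (w x) :: int fls) (Abs_fls (\<lambda>n. int (card {x \<in> A. w x = n}))) < r"
    unfolding eventually_finite_subsets_at_top using fin[of "int N"] by blast
qed

lemma infsum_fls_X_intpow_nth:
  fixes w :: "'a \<Rightarrow> int"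
  assumes "\<And>n. finite {x \<in> A. w x \<le> n}"
  shows "(\<Sum>\<^sub>\<infinity>x\<in>A. fls_X_intpow (w x) :: int fls) $$ k = int (card {x \<in> A. w x = k})"
  using infsumI[OF has_sum_fls_X_intpow[OF assms]] nth_Abs_fls_card_fibre[OF assms] by simp

section \<open>Beta-sets of charged partitions\<close>

text \<open>
  A single runner of the abacus, viewed as a function of its partition and its charge.
  The beta-numbers are listed in strictly decreasing order, and the list ends with
  all integers from some point downwards.
\<close>

definition beta_set :: "(nat \<Rightarrow> nat) \<Rightarrow> int \<Rightarrow> int set" where
  "beta_set p s = range (\<lambda>i. int (p i) - int i + s)"

lemma runner_conv_beta_set: "runner x j = beta_set (fst x ! (j - 1)) (snd x ! (j - 1))"
  by (auto simp: runner_def beta_set_def)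

lemma beta_set_shift: "z \<in> beta_set p (s + c) \<longleftrightarrow> z - c \<in> beta_set p s"
  by (simp add: beta_set_def image_iff diff_eq_eq add.assoc)

lemma partition_antimono: "is_partition p \<Longrightarrow> i \<le> j \<Longrightarrow> p j \<le> p i"
  by (simp add: is_partition_def decseq_def)

lemma partition_eventually_zero:
  assumes "is_partition p"
  obtains N where "\<And>i. N \<le> i \<Longrightarrow> p i = 0"
proof -
  have "finite {i. p i \<noteq> 0}" using assms by (simp add: is_partition_def)
  then obtain N where "{i. p i \<noteq> 0} \<subseteq> {..<N}" by (meson finite_nat_iff_bounded)
  then show ?thesis by (intro that[of N]) (auto simp: subset_iff)
qed

lemma beta_strict_antimono:
  assumes "is_partition p" "i < j"
  shows "int (p j) - int j + s < int (p i) - int i + s"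
  using partition_antimono[OF assms(1), of i j] assms(2) by linarith

lemma inj_beta: "is_partition p \<Longrightarrow> inj_on (\<lambda>i. int (p i) - int i + s) B"
  by (rule inj_onI) (metis beta_strict_antimono less_irrefl nat_neq_iff)

lemma beta_set_bounded: "is_partition p \<Longrightarrow> z \<in> beta_set p s \<Longrightarrow> z \<le> int (p 0) + s"
  using partition_antimono[of p 0] by (auto simp: beta_set_def) (smt (verit) of_nat_mono of_nat_0_le_iff)

lemma beta_set_contains_low:
  assumes "is_partition p"
  obtains L where "\<And>z. z \<le> L \<Longrightarrow> z \<in> beta_set p s"
proof -
  obtain N where N: "\<And>i. N \<le> i \<Longrightarrow> p i = 0" using partition_eventually_zero[OF assms] by blast
  have "z \<in> beta_set p s" if "z \<le> s - int N" for z
    unfolding beta_set_def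
    by (rule range_eqI[of _ _ "nat (s - z)"]) (use that N in auto)
  then show ?thesis by (rule that)
qed

text \<open>
  The beads of the zero parts are packed; the last nonzero part sits strictly above the
  place where it would touch them.  This single gap detects every nonempty partition.
\<close>

lemma beta_set_gap_below_last_part:
  assumes "is_partition p" "p i > 0" "p (Suc i) = 0"
  shows "s - int i \<notin> beta_set p s"
proof
  assume "s - int i \<in> beta_set p s"
  then obtain j where j: "int (p j) - int j + s = s - int i" by (auto simp: beta_set_def)
  show False
  proof (cases "j \<le> i")
    case True
    then show ?thesis using partition_antimono[OF assms(1) True] assms(2) j by linarith
  next
    case False
    then show ?thesis using partition_antimono[OF assms(1), of "Suc i" j] assms(3) j by linarith
  qed
qed

lemma partition_last_part:
  assumes "is_partition p" "p k \<noteq> 0"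
  obtains i where "k \<le> i" "p i > 0" "p (Suc i) = 0"
proof -
  let ?i = "Max {i. p i \<noteq> 0}"
  have fin: "finite {i. p i \<noteq> 0}" using assms(1) by (simp add: is_partition_def)
  have "?i \<in> {i. p i \<noteq> 0}" using fin assms(2) by (intro Max_in) auto
  moreover have "k \<le> ?i" using fin assms(2) by (intro Max_ge) auto
  moreover have "p (Suc ?i) = 0" using Max_ge[OF fin, of "Suc ?i"] by auto
  ultimately show ?thesis by (intro that[of ?i]) auto
qed

text \<open>
  When everything below \<open>m\<close> is occupied, the gap under the last nonzero part lies at
  height at least \<open>m\<close>.  So all beads below \<open>m\<close> belong to zero parts, and the beads from
  \<open>m\<close> upwards are exactly those of the first \<open>n\<close> parts.
\<close>

lemma beta_set_truncate:
  assumes "is_partition p" and low: "\<And>z. z < m \<Longrightarrow> z \<in> beta_set p s"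
  obtains n where "s = m - 1 + int n" "\<And>i. n \<le> i \<Longrightarrow> p i = 0"
    "{\<beta> \<in> beta_set p s. m \<le> \<beta>} = (\<lambda>i. int (p i) - int i + s) ` {..<n}"
proof -
  have zero: "p k = 0" if k: "s - int k < m" for k
  proof (rule ccontr)
    assume "p k \<noteq> 0"
    then obtain i where "k \<le> i" "p i > 0" "p (Suc i) = 0"
      using partition_last_part[OF assms(1)] by blast
    then show False using beta_set_gap_below_last_part[OF assms(1), of i s] low[of "s - int i"] k by force
  qed
  have "m - 1 \<le> s"
  proof (rule ccontr)
    assume *: "\<not> m - 1 \<le> s"
    then have "p 0 = 0" using zero[of 0] by simp
    then show False using beta_set_bounded[OF assms(1) low[of "m - 1"]] * by simp
  qed
  then have s: "s = m - 1 + int (nat (s - m + 1))" by simp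
  moreover have z: "p i = 0" if "nat (s - m + 1) \<le> i" for i
    using that by (intro zero) linarith
  moreover have "{\<beta> \<in> beta_set p s. m \<le> \<beta>} = (\<lambda>i. int (p i) - int i + s) ` {..<nat (s - m + 1)}"
  proof -
    have "m \<le> int (p i) - int i + s \<longleftrightarrow> i < nat (s - m + 1)" for i
      using z[of i] by (cases "i < nat (s - m + 1)") auto
    then show ?thesis by (auto simp: beta_set_def)
  qed
  ultimately show ?thesis by (rule that)
qed

text \<open>
  Moving every part down to zero turns the \<open>s - m + 1\<close> beads at height at least \<open>m\<close> into the
  interval from \<open>m\<close> to \<open>s\<close>, and lowers the sum of their positions by the size of the
  partition.  The sum is stated twice over to avoid a division by two.
\<close>

lemma beta_set_above:
  assumes "is_partition p" and "\<And>z. z < m \<Longrightarrow> z \<in> beta_set p s"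
  shows "finite {\<beta> \<in> beta_set p s. m \<le> \<beta>}"
    and "m - 1 \<le> s"
    and "int (card {\<beta> \<in> beta_set p s. m \<le> \<beta>}) = s - m + 1"
    and "2 * (\<Sum>\<beta> | \<beta> \<in> beta_set p s \<and> m \<le> \<beta>. \<beta>)
         = 2 * int (partition_size p) + 2 * (s - m + 1) * m + (s - m + 1) * (s - m)"
proof -
  obtain n where n: "s = m - 1 + int n" "\<And>i. n \<le> i \<Longrightarrow> p i = 0"
    and T: "{\<beta> \<in> beta_set p s. m \<le> \<beta>} = (\<lambda>i. int (p i) - int i + s) ` {..<n}"
    using beta_set_truncate[OF assms] by blast
  show "finite {\<beta> \<in> beta_set p s. m \<le> \<beta>}" using T by simp
  show "m - 1 \<le> s" using n(1) by simp
  show "int (card {\<beta> \<in> beta_set p s. m \<le> \<beta>}) = s - m + 1"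
    unfolding T card_image[OF inj_beta[OF assms(1)]] using n(1) by simp
  have "(\<Sum>i<n. p i) = partition_size p"
    unfolding partition_size_def using n(2) by (intro sum.mono_neutral_right) (auto simp: not_less[symmetric] intro: ccontr)
  moreover have "2 * (\<Sum>i<n. s - int i) = 2 * int n * m + int n * (int n - 1)"
  proof -
    have "2 * (\<Sum>i<k. s - int i) = 2 * int k * s - int k * (int k - 1)" for k
      by (induction k) (auto simp: algebra_simps)
    from this[of n] show ?thesis by (simp add: n(1) algebra_simps)
  qed
  moreover have "(\<Sum>\<beta> | \<beta> \<in> beta_set p s \<and> m \<le> \<beta>. \<beta>) = int (\<Sum>i<n. p i) + (\<Sum>i<n. s - int i)"
    unfolding T by (subst sum.reindex[OF inj_beta[OF assms(1)]]) (simp add: sum.distrib[symmetric] algebra_simps)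
  ultimately show "2 * (\<Sum>\<beta> | \<beta> \<in> beta_set p s \<and> m \<le> \<beta>. \<beta>)
         = 2 * int (partition_size p) + 2 * (s - m + 1) * m + (s - m + 1) * (s - m)"
    using n(1) by simp
qed

text \<open>
  Above a sufficiently low level the number of beads is determined by the charge alone, so
  the charge is monotone under inclusion.
\<close>

lemma beta_set_subset_imp_charge_le:
  assumes "is_partition p" "is_partition p'" "beta_set p s \<subseteq> beta_set p' s'"
  shows "s \<le> s'"
proof -
  obtain L where L: "\<And>z. z \<le> L \<Longrightarrow> z \<in> beta_set p s" using beta_set_contains_low[OF assms(1)] by blast
  have low: "\<And>z. z < L \<Longrightarrow> z \<in> beta_set p s" "\<And>z. z < L \<Longrightarrow> z \<in> beta_set p' s'"
    using L assms(3) by auto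
  have "card {\<beta> \<in> beta_set p s. L \<le> \<beta>} \<le> card {\<beta> \<in> beta_set p' s'. L \<le> \<beta>}"
    by (rule card_mono) (use assms(3) beta_set_above(1)[OF assms(2) low(2)] in auto)
  then show ?thesis
    using beta_set_above(3)[of p L s] beta_set_above(3)[of p' L s'] assms(1,2) low by simp
qed

lemma beta_set_down_closed_iff:
  assumes "is_partition p"
  shows "(\<forall>z\<in>beta_set p s. z - 1 \<in> beta_set p s) \<longleftrightarrow> p = (\<lambda>_. 0)"
proof
  assume down: "\<forall>z\<in>beta_set p s. z - 1 \<in> beta_set p s"
  have down': "z - int n \<in> beta_set p s" if "z \<in> beta_set p s" for z n
  proof (induction n)
    case (Suc n)
    then show ?case using down by (force simp: algebra_simps)
  qed (use that in simp)
  show "p = (\<lambda>_. 0)"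
  proof (rule ccontr)
    assume "p \<noteq> (\<lambda>_. 0)"
    then obtain k where "p k \<noteq> 0" by auto
    then obtain i where i: "p i > 0" "p (Suc i) = 0" using partition_last_part[OF assms] by blast
    have "int (p i) - int i + s \<in> beta_set p s" by (auto simp: beta_set_def)
    from down'[OF this, of "p i"] show False using beta_set_gap_below_last_part[OF assms i, of s] by (simp add: algebra_simps)
  qed
next
  assume p: "p = (\<lambda>_. 0)"
  show "\<forall>z\<in>beta_set p s. z - 1 \<in> beta_set p s"
    by (auto simp: beta_set_def p image_iff intro!: exI[of _ "Suc _"])
qed

text \<open>
  Inclusion both ways gives equal charges.  Since the enumeration is strictly decreasing,
  its values are then determined one after the other as the largest remaining bead.
\<close>

lemma beta_set_inject:
  assumes "is_partition p" "is_partition p'" "beta_set p s = beta_set p' s'"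
  shows "p = p' \<and> s = s'"
proof -
  have s: "s = s'"
    using beta_set_subset_imp_charge_le[OF assms(1,2)] beta_set_subset_imp_charge_le[OF assms(2,1)] assms(3)
    by (simp add: order_antisym)
  have "int (p n) - int n + s = int (p' n) - int n + s" for n
  proof (induction n rule: less_induct)
    case (less n)
    \<comment> \<open>One inequality between the \<open>n\<close>-th values, in a form that is symmetric in the two partitions.\<close>
    have aux: "int (q n) - int n + s \<le> int (q' n) - int n + s"
      if q: "is_partition q" "is_partition q'" "beta_set q s = beta_set q' s"
        "\<And>k. k < n \<Longrightarrow> q k = q' k" for q q'
    proof -
      have "int (q n) - int n + s \<in> beta_set q' s" using q(3) by (auto simp: beta_set_def)
      then obtain k where k: "int (q n) - int n + s = int (q' k) - int k + s" by (auto simp: beta_set_def)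
      have "n \<le> k"
        using k q(4)[of k] beta_strict_antimono[OF q(1), of k n s] by force
      then show ?thesis
        using k beta_strict_antimono[OF q(2), of n k s] by (cases "n = k") auto
    qed
    have "\<And>k. k < n \<Longrightarrow> p k = p' k" using less by simp
    then show ?case using aux[of p p'] aux[of p' p] assms s by force
  qed
  then show ?thesis using s by auto
qed

text \<open>
  Enumerate \<open>S\<close> decreasingly from an upper bound \<open>M\<close>, as \<open>M - a i\<close> with \<open>a\<close> strictly
  increasing.  The difference \<open>a i - i\<close> counts the holes above the \<open>i\<close>-th bead; it increases
  and is eventually constant because no holes remain far down.  The number of holes still
  below the \<open>i\<close>-th bead is the \<open>i\<close>-th part, and the total number of holes gives the charge.
\<close>

lemma beta_set_exists:
  assumes up: "\<And>z. z \<in> S \<Longrightarrow> z \<le> M" and low: "\<And>z. z \<le> L \<Longrightarrow> z \<in> S"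
  shows "\<exists>p s. is_partition p \<and> S = beta_set p s"
proof -
  define T where "T = {n. M - int n \<in> S}"
  have "{nat (M - L)..} \<subseteq> T" by (auto simp: T_def intro!: low)
  then have inf: "infinite T" using infinite_Ici infinite_super by blast
  define a where "a = enumerate T"
  have mono: "strict_mono a" and ran: "range a = T"
    using inf by (auto simp: a_def strict_mono_enumerate range_enumerate)
  have step: "int (a i) - int i \<le> int (a (Suc i)) - int (Suc i)" for i
    using strict_monoD[OF mono, of i "Suc i"] by simp
  define N where "N = nat (M - L)"
  have "N \<le> a N" using inf by (simp add: a_def le_enumerate)
  have const: "int (a i) - int i = int (a N) - int N" if "N \<le> i" for i
    using that
  proof (induction i rule: dec_induct)
    case (step i)
    have "N \<le> a i" using step(1) \<open>N \<le> a N\<close> strict_mono_less_eq[OF mono, of N i] by linarith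
    then have "Suc (a i) \<in> T" using \<open>{nat (M - L)..} \<subseteq> T\<close> by (auto simp: N_def)
    then obtain k where k: "a k = Suc (a i)" using ran by (metis imageE)
    then have "i < k" using strict_mono_less[OF mono, of i k] by simp
    then have "a (Suc i) \<le> Suc (a i)" using k strict_mono_less_eq[OF mono, of "Suc i" k] by simp
    moreover have "a i < a (Suc i)" using strict_monoD[OF mono] by simp
    ultimately show ?case using step by simp
  qed simp
  have incr: "int (a i) - int i \<le> int (a j) - int j" if "i \<le> j" for i j
    using lift_Suc_mono_le[of "\<lambda>i. int (a i) - int i", OF step that] .
  have le: "int (a i) - int i \<le> int (a N) - int N" for i
    using incr[of i N] const[of i] by (cases "i \<le> N") auto
  define s where "s = M - (int (a N) - int N)"
  define p where "p i = nat ((int (a N) - int N) - (int (a i) - int i))" for i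
  have p: "int (p i) - int i + s = M - int (a i)" for i using le[of i] by (simp add: p_def s_def)
  have "decseq p" unfolding decseq_def p_def by (intro allI impI nat_mono diff_left_mono incr)
  moreover have "finite {i. p i \<noteq> 0}"
  proof (rule finite_subset)
    have "p i = 0" if "N \<le> i" for i using const[OF that] by (simp add: p_def)
    then show "{i. p i \<noteq> 0} \<subseteq> {..<N}" using not_less by auto
  qed simp
  moreover have "S = beta_set p s"
  proof -
    have "z \<in> (\<lambda>i. M - int i) ` T" if "z \<in> S" for z
      by (rule image_eqI[of _ _ "nat (M - z)"]) (use that up[OF that] in \<open>auto simp: T_def\<close>)
    then have "S = (\<lambda>i. M - int i) ` T" by (auto simp: T_def)
    also have "\<dots> = beta_set p s" unfolding beta_set_def p ran[symmetric] by (simp add: image_image)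
    finally show ?thesis .
  qed
  ultimately show ?thesis by (auto simp: is_partition_def)
qed

section \<open>The rank of a charged multipartition\<close>

lemma floor_of_int_divide_double_nat:
  "\<lfloor>real_of_int a / real_of_int (2 * int l)\<rfloor> = a div (2 * int l)"
  by (metis floor_divide_of_int_eq)

lemma ceiling_of_int_divide_double_nat:
  "\<lceil>real_of_int a / real_of_int (2 * int l)\<rceil> = - ((- a) div (2 * int l))"
  by (metis ceiling_divide_eq_div)

text \<open>
  The quadratic form defining the rank of a charge only sees differences of the entries, so a
  common translation by \<open>a\<close> does not matter.  Written out, the form is
  \<open>l \<Sum> n\<^sub>j\<^sup>2 - (\<Sum> n\<^sub>j)\<^sup>2\<close>.
\<close>

lemma charge_rank_translate:
  fixes a :: int
  assumes "length t = l"
  defines "n \<equiv> \<lambda>j. t ! j - a"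
  shows "charge_rank t =
    - (((\<Sum>j<l. n j)\<^sup>2 - int l * (\<Sum>j<l. (n j)\<^sup>2) + int l - 1) div (2 * int l))"
proof -
  have "(\<Sum>j\<in>{..<l} - {i}. t ! i * (t ! i - t ! j)) = (\<Sum>j<l. (n i + a) * (n i - n j))" if "i < l" for i
    using that by (subst sum.remove[of _ i]) (auto simp: n_def)
  then have "(\<Sum>i<l. \<Sum>j\<in>{..<l} - {i}. t ! i * (t ! i - t ! j))
       = (\<Sum>i<l. \<Sum>j<l. (n i + a) * (n i - n j))" by simp
  also have "\<dots> = int l * (\<Sum>j<l. (n j)\<^sup>2) - (\<Sum>j<l. n j)\<^sup>2"
    by (simp add: algebra_simps sum.distrib sum_subtractf sum_distrib_left[symmetric]
        sum_distrib_right[symmetric] power2_eq_square)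
  finally have Y: "(\<Sum>i<l. \<Sum>j\<in>{..<l} - {i}. t ! i * (t ! i - t ! j))
      = int l * (\<Sum>j<l. (n j)\<^sup>2) - (\<Sum>j<l. n j)\<^sup>2" .
  show ?thesis
    unfolding charge_rank_def Let_def assms(1) ceiling_of_int_divide_double_nat Y by (simp add: algebra_simps)
qed

lemma multipartition_size_conv_sum:
  "length lam = l \<Longrightarrow> multipartition_size lam = (\<Sum>j<l. partition_size (lam ! j))"
  by (auto simp: multipartition_size_def sum_list_sum_nth atLeast0LessThan)

text \<open>
  \<open>LEAST\<close> on the integers is meaningful only for a nonempty set that is bounded below.  Both
  hold here: some position above the first runner is empty, and all runners
  contain every sufficiently small integer.
\<close>

lemma least_missing_position:
  assumes l: "l \<ge> 1" and lam: "is_multipartition l lam" and "length t = l"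
  obtains m where "(LEAST z. \<exists>j\<in>{1..l}. z \<notin> runner (lam, t) j) = m"
    "\<And>j z. j < l \<Longrightarrow> z < m \<Longrightarrow> z \<in> beta_set (lam ! j) (t ! j)"
proof -
  define P where "P z \<longleftrightarrow> (\<exists>j\<in>{1..l}. z \<notin> runner (lam, t) j)" for z
  have part: "is_partition (lam ! j)" if "j < l" for j
    using lam that by (auto simp: is_multipartition_def)
  have "\<forall>j\<in>{..<l}. \<exists>L. \<forall>z\<le>L. z \<in> beta_set (lam ! j) (t ! j)"
    using part beta_set_contains_low by (metis lessThan_iff)
  then obtain L where L: "\<And>j z. j < l \<Longrightarrow> z \<le> L j \<Longrightarrow> z \<in> beta_set (lam ! j) (t ! j)"
    by (metis lessThan_iff)
  define K where "K = Min (L ` {..<l})"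
  have K: "K \<le> L j" if "j < l" for j using that by (auto simp: K_def)
  have lower: "z > K" if "P z" for z
  proof (rule ccontr)
    assume "\<not> z > K"
    then have "z \<in> runner (lam, t) j" if "j \<in> {1..l}" for j
    proof -
      have "j - 1 < l" using that l by auto
      then show ?thesis using K[of "j - 1"] L[of "j - 1" z] \<open>\<not> z > K\<close> by (simp add: runner_conv_beta_set)
    qed
    then show False using \<open>P z\<close> by (auto simp: P_def)
  qed
  have "P (int ((lam ! 0) 0) + t ! 0 + 1)"
    unfolding P_def using beta_set_bounded[OF part[of 0], of _ "t ! 0"] l
    by (intro bexI[of _ 1]) (fastforce simp: runner_conv_beta_set)+
  then obtain m where m: "P m" "\<And>z. P z \<Longrightarrow> nat (m - K) \<le> nat (z - K)"
    using ex_has_least_nat[of P _ "\<lambda>z. nat (z - K)"] by blast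
  have le: "m \<le> z" if "P z" for z using m(2)[OF that] lower[OF that] lower[OF m(1)] by linarith
  have "Least P = m" using m(1) le by (intro Least_equality)
  moreover have "z \<in> beta_set (lam ! j) (t ! j)" if "j < l" "z < m" for j z
  proof -
    have "\<not> P z" using le that(2) by force
    then show ?thesis using that(1) by (force simp: P_def runner_conv_beta_set dest: bspec[of _ _ "Suc j"])
  qed
  ultimately show ?thesis using that unfolding P_def by blast
qed

text \<open>
  The rank separates into a contribution of the partitions and one of the charge.  With
  \<open>n\<^sub>j = t\<^sub>j - m + 1\<close> beads of runner \<open>j\<close> above the reference point, the sum of the bead
  heights relative to \<open>m\<close> is the total size plus \<open>\<Sum> n\<^sub>j (n\<^sub>j - 1) / 2\<close>.  Moving this
  last integer inside the floor gives the rounded quadratic form of the charge.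
\<close>

lemma charged_rank_eq_size_plus_charge_rank:
  assumes l: "l \<ge> 1" and lam: "is_multipartition l lam" and len: "length t = l"
  shows "charged_rank (lam, t) = int (multipartition_size lam) + charge_rank t"
proof -
  obtain m where m: "(LEAST z. \<exists>j\<in>{1..l}. z \<notin> runner (lam, t) j) = m"
    and low: "\<And>j z. j < l \<Longrightarrow> z < m \<Longrightarrow> z \<in> beta_set (lam ! j) (t ! j)"
    using least_missing_position[OF assms] by blast
  have llen: "length lam = l" using lam by (simp add: is_multipartition_def)
  have part: "is_partition (lam ! j)" if "j < l" for j
    using lam that by (auto simp: is_multipartition_def)
  define n where "n j = t ! j - (m - 1)" for j
  define tail where "tail j = {\<beta> \<in> beta_set (lam ! j) (t ! j). m \<le> \<beta>}" for j
  have tl: "finite (tail j)" "int (card (tail j)) = n j"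
    "2 * (\<Sum>\<beta>\<in>tail j. \<beta>) = 2 * int (partition_size (lam ! j)) + 2 * n j * m + n j * (n j - 1)"
    if "j < l" for j
    using beta_set_above[of "lam ! j" m "t ! j"] part[OF that] low[OF that]
    by (simp_all add: tail_def n_def algebra_simps)
  define c where "c = (\<Sum>j<l. n j)"
  have "{(\<beta>, j). (\<beta>, j) \<in> abacus (lam, t) \<and> m \<le> \<beta>} = (\<lambda>(j, \<beta>). (\<beta>, Suc j)) ` (SIGMA j:{..<l}. tail j)"
  proof (intro set_eqI iffI; clarify)
    fix \<beta> j assume "(\<beta>, j) \<in> abacus (lam, t)" "m \<le> \<beta>"
    then show "(\<beta>, j) \<in> (\<lambda>(j, \<beta>). (\<beta>, Suc j)) ` (SIGMA j:{..<l}. tail j)"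
      by (intro image_eqI[of _ _ "(j - 1, \<beta>)"])
         (auto simp: abacus_def runner_conv_beta_set tail_def len)
  qed (auto simp: abacus_def runner_conv_beta_set tail_def len)
  then have "card {(\<beta>, j). (\<beta>, j) \<in> abacus (lam, t) \<and> m \<le> \<beta>} = card (SIGMA j:{..<l}. tail j)"
    by (simp add: card_image inj_on_def)
  also have "\<dots> = (\<Sum>j<l. card (tail j))" using tl(1) by (intro card_SigmaI) auto
  finally have card: "int (card {(\<beta>, j). (\<beta>, j) \<in> abacus (lam, t) \<and> m \<le> \<beta>}) = c"
    using tl(2) by (simp add: c_def)
  define q where "q = (\<Sum>j<l. (n j)\<^sup>2)"
  have "(\<Sum>j = 1..l. \<Sum>\<beta> | \<beta> \<in> runner (lam, t) j \<and> \<beta> \<ge> m. \<beta>) = (\<Sum>j<l. \<Sum>\<beta>\<in>tail j. \<beta>)"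
    unfolding lessThan_atLeast0 
    by (rule sum.reindex_bij_witness[of _ Suc "\<lambda>j. j - 1"]) (auto simp: runner_conv_beta_set tail_def)
  moreover have "2 * (\<Sum>j<l. \<Sum>\<beta>\<in>tail j. \<beta>) = 2 * int (multipartition_size lam) + 2 * c * m + q - c"
  proof -
    have "2 * (\<Sum>j<l. \<Sum>\<beta>\<in>tail j. \<beta>)
      = (\<Sum>j<l. 2 * int (partition_size (lam ! j)) + 2 * n j * m + (n j)\<^sup>2 - n j)"
      unfolding sum_distrib_left[of _ _ "{..<l}"]
      by (rule sum.cong) (use tl(3) in \<open>simp_all add: power2_eq_square algebra_simps\<close>)
    also have "\<dots> = 2 * int (multipartition_size lam) + 2 * c * m + q - c"
      by (simp add: multipartition_size_conv_sum[OF llen] c_def q_def sum.distrib sum_subtractf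
          sum_distrib_left sum_distrib_right)
    finally show ?thesis .
  qed
  moreover obtain Z where Z: "q - c = 2 * Z"
  proof -
    have "even (q - c)" unfolding q_def c_def sum_subtractf[symmetric] by (intro dvd_sum) auto
    then show ?thesis using that by (elim evenE)
  qed
  ultimately have S: "(\<Sum>j = 1..l. \<Sum>\<beta> | \<beta> \<in> runner (lam, t) j \<and> \<beta> \<ge> m. \<beta>)
      = int (multipartition_size lam) + c * m + Z" by simp
  have q: "q = c + 2 * Z" using Z by simp
  \<comment> \<open>The correction term of the rank differs from the numerator for the charge by a multiple of \<open>2 l\<close>.\<close>
  have "((c - 1) * (c - int l + 1)) = (c\<^sup>2 - int l * q + int l - 1) + Z * (2 * int l)"
    by (simp add: q power2_eq_square algebra_simps)
  then have "((c - 1) * (c - int l + 1)) div (2 * int l) = Z + (c\<^sup>2 - int l * q + int l - 1) div (2 * int l)"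
    using l by (simp only: div_mult_self1)
  then have "charged_rank (lam, t) = int (multipartition_size lam) - (c\<^sup>2 - int l * q + int l - 1) div (2 * int l)"
    unfolding charged_rank_def Let_def snd_conv len m card S floor_of_int_divide_double_nat by simp
  also have "\<dots> = int (multipartition_size lam) + charge_rank t"
    using charge_rank_translate[OF len, of "m - 1"] by (simp add: n_def c_def q_def)
  finally show ?thesis .
qed

section \<open>Level-rank duality and interlacing runners\<close>

lemma runner_conv_abacus:
  "1 \<le> j \<Longrightarrow> j \<le> length (snd x) \<Longrightarrow> runner x j = {\<beta>. (\<beta>, j) \<in> abacus x}"
  by (simp add: abacus_def)

text \<open>
  This makes the definite description of the level-rank dual meaningful: a bead
  configuration is the abacus of exactly one charged multipartition as soon as
  its runners are uniformly bounded above and full far down.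
\<close>

lemma ex1_charged_multipartition:
  assumes rng: "\<And>\<beta> j. (\<beta>, j) \<in> B \<Longrightarrow> 1 \<le> j \<and> j \<le> e"
    and up: "\<And>\<beta> j. (\<beta>, j) \<in> B \<Longrightarrow> \<beta> \<le> M"
    and low: "\<And>\<beta> j. 1 \<le> j \<Longrightarrow> j \<le> e \<Longrightarrow> \<beta> \<le> L \<Longrightarrow> (\<beta>, j) \<in> B"
  shows "\<exists>!y. is_charged_multipartition e y \<and> abacus y = B"
proof (rule ex_ex1I)
  have "\<exists>p s. is_partition p \<and> {\<beta>. (\<beta>, Suc j) \<in> B} = beta_set p s" if "j < e" for j
    using beta_set_exists[of "{\<beta>. (\<beta>, Suc j) \<in> B}" M L] up low that by auto
  then obtain p s where ps: "\<And>j. j < e \<Longrightarrow> is_partition (p j) \<and> {\<beta>. (\<beta>, Suc j) \<in> B} = beta_set (p j) (s j)"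
    by metis
  let ?y = "(map p [0..<e], map s [0..<e])"
  have "(\<beta>, j) \<in> abacus ?y \<longleftrightarrow> (\<beta>, j) \<in> B" for \<beta> j
  proof (cases "1 \<le> j \<and> j \<le> e")
    case True
    then have "(\<beta>, j) \<in> abacus ?y \<longleftrightarrow> \<beta> \<in> beta_set (p (j - 1)) (s (j - 1))"
      by (auto simp: abacus_def runner_conv_beta_set)
    also have "\<dots> \<longleftrightarrow> (\<beta>, j) \<in> B"
    proof -
      have "j - 1 < e" "Suc (j - 1) = j" using True by auto
      then have "{\<beta>. (\<beta>, j) \<in> B} = beta_set (p (j - 1)) (s (j - 1))" using ps[of "j - 1"] by simp
      then show ?thesis by blast
    qed
    finally show ?thesis .
  next
    case False
    then show ?thesis using rng by (auto simp: abacus_def)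
  qed
  then have "abacus ?y = B" by auto
  moreover have "is_charged_multipartition e ?y"
    using ps by (auto simp: is_charged_multipartition_def is_multipartition_def)
  ultimately show "\<exists>y. is_charged_multipartition e y \<and> abacus y = B" by blast
next
  fix y y' assume y: "is_charged_multipartition e y \<and> abacus y = B"
    and y': "is_charged_multipartition e y' \<and> abacus y' = B"
  have len: "length (fst y) = e" "length (snd y) = e" "length (fst y') = e" "length (snd y') = e"
    using y y' by (auto simp: is_charged_multipartition_def is_multipartition_def)
  have "fst y ! j = fst y' ! j \<and> snd y ! j = snd y' ! j" if "j < e" for j
  proof (rule beta_set_inject)
    show "is_partition (fst y ! j)" "is_partition (fst y' ! j)"
      using y y' len that by (auto simp: is_charged_multipartition_def is_multipartition_def)
    show "beta_set (fst y ! j) (snd y ! j) = beta_set (fst y' ! j) (snd y' ! j)"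
      using runner_conv_abacus[of "Suc j" y] runner_conv_abacus[of "Suc j" y'] len that y y'
      by (simp add: runner_conv_beta_set)
  qed
  then show "y = y'" using len by (auto intro!: prod_eqI nth_equalityI)
qed

text \<open>
  Writing a position as \<open>q e + i\<close> with \<open>1 \<le> i \<le> e\<close> removes the division from the map:
  the residue \<open>i\<close> becomes the new runner, and \<open>q\<close> together with the old runner \<open>j\<close> becomes the
  new height.
\<close>

lemma level_rank_map_eq:
  assumes "1 \<le> i" "i \<le> e"
  shows "level_rank_map l e (q * int e + int i, j) = (int l * (q + 1) - int j + 1, i)"
proof -
  have "q * int e + int i - 1 = int (i - 1) + q * int e" using assms by (simp add: of_nat_diff)
  moreover have "(int (i - 1) + q * int e) div int e = q" "(int (i - 1) + q * int e) mod int e = int (i - 1)"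
    using assms by auto
  moreover have "nat (int (i - 1)) + 1 = i" using assms by simp
  ultimately show ?thesis unfolding level_rank_map_def by (simp only: prod.case)
qed

lemma position_decomp:
  fixes k :: int
  assumes "e \<ge> 1"
  obtains q i where "1 \<le> i" "i \<le> e" "k = q * int e + int i"
proof -
  have "0 \<le> (k - 1) mod int e" "(k - 1) mod int e < int e" using assms by auto
  moreover have "k = (k - 1) div int e * int e + (k - 1) mod int e + 1" by simp
  ultimately show ?thesis
    by (intro that[of "nat ((k - 1) mod int e + 1)" "(k - 1) div int e"]) linarith+
qed

text \<open>
  On every runner of the dual abacus the heights are grouped into blocks of length \<open>l\<close>, and
  the old runners occur in each block from top to bottom in the order \<open>1, \<dots>, l\<close>.
\<close>

lemma level_rank_height_decomp:
  fixes b :: int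
  assumes "l \<ge> 1"
  obtains q j where "1 \<le> j" "j \<le> l" "b = int l * (q + 1) - int j + 1"
proof -
  obtain q' i where i: "1 \<le> i" "i \<le> l" "b = q' * int l + int i"
    using position_decomp[OF assms] by blast
  show ?thesis by (rule that[of "l + 1 - i" q']) (use i in \<open>auto simp: of_nat_diff algebra_simps\<close>)
qed

lemma level_rank_height_unique:
  assumes "1 \<le> j" "j \<le> l" "1 \<le> j'" "j' \<le> l"
    "int l * (q + 1) - int j + 1 = int l * (q' + 1) - int j' + 1"
  shows "q = q' \<and> j = j'"
proof -
  have div: "(int l * (q + 1) - int j) div int l = q" if "1 \<le> j" "j \<le> l" for q j
  proof -
    have "int l * (q + 1) - int j = int (l - j) + q * int l" using that by (simp add: of_nat_diff algebra_simps)
    then show ?thesis using that by (simp del: of_nat_diff)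
  qed
  have "q = q'" using div[OF assms(1,2), of q] div[OF assms(3,4), of q'] assms(5) by simp
  then show ?thesis using assms(5) by simp
qed

lemma level_rank_image_iff:
  assumes e: "e \<ge> 1" and l: "length (snd x) = l" and "1 \<le> i" "i \<le> e" "1 \<le> j" "j \<le> l"
  shows "(int l * (q + 1) - int j + 1, i) \<in> level_rank_map l e ` abacus x
           \<longleftrightarrow> q * int e + int i \<in> runner x j"
proof
  assume "q * int e + int i \<in> runner x j"
  then have "(q * int e + int i, j) \<in> abacus x" using assms by (simp add: abacus_def)
  then show "(int l * (q + 1) - int j + 1, i) \<in> level_rank_map l e ` abacus x"
    using level_rank_map_eq[OF assms(3,4), of l q j] by (metis image_eqI)
next
  assume "(int l * (q + 1) - int j + 1, i) \<in> level_rank_map l e ` abacus x"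
  then obtain k j' where kj: "(k, j') \<in> abacus x" "level_rank_map l e (k, j') = (int l * (q + 1) - int j + 1, i)"
    by auto
  obtain q' i' where k: "1 \<le> i'" "i' \<le> e" "k = q' * int e + int i'" using position_decomp[OF e] by blast
  have j': "1 \<le> j'" "j' \<le> l" "k \<in> runner x j'" using kj(1) l by (auto simp: abacus_def)
  have eq: "int l * (q' + 1) - int j' + 1 = int l * (q + 1) - int j + 1" "i' = i"
    using kj(2) level_rank_map_eq[OF k(1,2), of l q' j'] k(3) by auto
  then show "q * int e + int i \<in> runner x j"
    using level_rank_height_unique[OF j'(1,2) assms(5,6) eq(1)] k j' by simp
qed

text \<open>
  Boundedness of the dual abacus comes from the estimates on \<open>x\<close>: heights and positions are
  related by a factor \<open>l / e\<close> up to a bounded error.  The bounds \<open>M \<ge> 0\<close> and \<open>K \<le> 0\<close> are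
  chosen with these signs so that multiplying a quotient by \<open>e \<ge> 1\<close> keeps the estimates.
\<close>

lemma level_rank_spec:
  assumes x: "is_charged_multipartition l x" and l: "l \<ge> 1" and e: "e \<ge> 1"
  shows "is_charged_multipartition e (level_rank e x)"
    and "abacus (level_rank e x) = level_rank_map l e ` abacus x"
proof -
  let ?B = "level_rank_map l e ` abacus x"
  have len: "length (snd x) = l" "length (fst x) = l" 
    and part: "\<And>j. j < l \<Longrightarrow> is_partition (fst x ! j)"
    using x by (auto simp: is_charged_multipartition_def is_multipartition_def)
  define M where "M = Max (insert 0 ((\<lambda>j. int ((fst x ! j) 0) + snd x ! j) ` {..<l}))"
  have M: "\<beta> \<le> M" if "\<beta> \<in> runner x j" "1 \<le> j" "j \<le> l" for \<beta> j
  proof -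
    have "\<beta> \<le> int ((fst x ! (j - 1)) 0) + snd x ! (j - 1)"
      using that beta_set_bounded[OF part[of "j - 1"]] by (simp add: runner_conv_beta_set)
    also have "\<dots> \<le> M" unfolding M_def using that by (intro Max_ge) auto
    finally show ?thesis .
  qed
  have "M \<ge> 0" by (auto simp: M_def)
  have "\<forall>j. \<exists>L. j < l \<longrightarrow> (\<forall>z\<le>L. z \<in> beta_set (fst x ! j) (snd x ! j))"
    using part beta_set_contains_low by metis
  then obtain L where L: "\<And>j z. j < l \<Longrightarrow> z \<le> L j \<Longrightarrow> z \<in> beta_set (fst x ! j) (snd x ! j)"
    by metis
  define K where "K = Min (insert 0 (L ` {..<l}))"
  have K: "\<beta> \<in> runner x j" if "\<beta> \<le> K" "1 \<le> j" "j \<le> l" for \<beta> j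
  proof -
    have "K \<le> L (j - 1)" unfolding K_def using that by (intro Min_le) auto
    then show ?thesis using L[of "j - 1" \<beta>] that by (simp add: runner_conv_beta_set)
  qed
  have "K \<le> 0" by (auto simp: K_def)
  have rng: "1 \<le> i \<and> i \<le> e" if bB: "(b, i) \<in> ?B" for b i
  proof -
    obtain k j where "(b, i) = level_rank_map l e (k, j)" using bB by auto
    then have "i = nat ((k - 1) mod int e) + 1" by (simp add: level_rank_map_def)
    moreover have "0 \<le> (k - 1) mod int e" "(k - 1) mod int e < int e" using e by auto
    ultimately show ?thesis by linarith
  qed
  have up: "b \<le> int l * (M + 1)" if bB: "(b, i) \<in> ?B" for b i
  proof -
    obtain q j where qj: "1 \<le> j" "j \<le> l" "b = int l * (q + 1) - int j + 1"
      using level_rank_height_decomp[OF l] by blast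
    have "q * int e + int i \<le> M"
      using bB rng[OF bB] level_rank_image_iff[OF e len(1) _ _ qj(1,2)] M qj by auto
    have "q \<le> M"
    proof (cases "q \<ge> 0")
      case True
      then have "q \<le> q * int e" using e by (simp add: mult_le_cancel_left1)
      then show ?thesis using \<open>q * int e + int i \<le> M\<close> by linarith
    qed (use \<open>M \<ge> 0\<close> in auto)
    have "b \<le> int l * (q + 1)" using qj by simp
    also have "\<dots> \<le> int l * (M + 1)" using \<open>q \<le> M\<close> by (intro mult_left_mono) auto
    finally show ?thesis .
  qed
  have low: "(b, i) \<in> ?B" if i: "1 \<le> i" "i \<le> e" and b: "b \<le> int l * (K - 1)" for b i
  proof -
    obtain q j where qj: "1 \<le> j" "j \<le> l" "b = int l * (q + 1) - int j + 1"
      using level_rank_height_decomp[OF l] by blast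
    then have "int l * q < int l * (K - 1)" using b by (simp add: algebra_simps)
    then have "q < K - 1" by (simp add: mult_less_cancel_left)
    then have "(q + 1) * int e \<le> (q + 1) * 1" using e \<open>K \<le> 0\<close> by (intro mult_left_mono_neg) auto
    then have "q * int e + int i \<le> K" using \<open>q < K - 1\<close> i by (simp add: algebra_simps)
    then show ?thesis using level_rank_image_iff[OF e len(1) i qj(1,2)] K qj by auto
  qed
  have "\<exists>!y. is_charged_multipartition e y \<and> abacus y = ?B"
    by (rule ex1_charged_multipartition[OF rng up low])
  from theI'[OF this] show "is_charged_multipartition e (level_rank e x)"
    "abacus (level_rank e x) = ?B" by (auto simp: level_rank_def len)
qed

text \<open>
  The dual \<open>e\<close>-partition is empty iff every bead of the dual abacus has a bead directly below
  it.  One step down on a dual runner is a step to the next old runner at the same position,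
  except that from the last old runner it leads to the first one, \<open>e\<close> positions lower.
  So emptiness says that the runners form the chain
  \<open>S\<^sub>1 \<subseteq> S\<^sub>2 \<subseteq> \<dots> \<subseteq> S\<^sub>l \<subseteq> S\<^sub>1 + e\<close>.
\<close>

lemma es_core_iff_interlacing:
  assumes len: "length s = l" and l: "l \<ge> 1" and e: "e \<ge> 1"
  shows "es_core e s lam \<longleftrightarrow> is_multipartition l lam \<and>
    (\<forall>j\<in>{1..l}. \<forall>\<beta>\<in>runner (lam, s) j.
       if j = l then \<beta> - int e \<in> runner (lam, s) 1 else \<beta> \<in> runner (lam, s) (j + 1))"
proof (cases "is_multipartition l lam")
  case False
  then show ?thesis by (simp add: es_core_def len)
next
  case True
  define x where "x = (lam, s)"
  define y where "y = level_rank e x"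
  define B where "B = level_rank_map l e ` abacus x"
  have x: "is_charged_multipartition l x" using True len by (simp add: is_charged_multipartition_def x_def)
  have y: "is_charged_multipartition e y" "abacus y = B"
    using level_rank_spec[OF x l e] by (auto simp: y_def B_def)
  have ylen: "length (fst y) = e" "length (snd y) = e" and ypart: "\<And>i. i < e \<Longrightarrow> is_partition (fst y ! i)"
    using y by (auto simp: is_charged_multipartition_def is_multipartition_def)
  have B: "(int l * (q + 1) - int j + 1, i) \<in> B \<longleftrightarrow> q * int e + int i \<in> runner x j"
    if "1 \<le> i" "i \<le> e" "1 \<le> j" "j \<le> l" for q i j
    unfolding B_def using that by (intro level_rank_image_iff[OF e]) (auto simp: x_def len)
  have "fst y = empty_multipartition e \<longleftrightarrow> (\<forall>i<e. fst y ! i = (\<lambda>_. 0))"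
    using ylen by (auto simp: empty_multipartition_def list_eq_iff_nth_eq)
  also have "\<dots> \<longleftrightarrow> (\<forall>i<e. \<forall>b\<in>runner y (Suc i). b - 1 \<in> runner y (Suc i))"
    using beta_set_down_closed_iff[OF ypart] by (simp add: runner_conv_beta_set)
  also have "\<dots> \<longleftrightarrow> (\<forall>i\<in>{1..e}. \<forall>b. (b, i) \<in> B \<longrightarrow> (b - 1, i) \<in> B)"
  proof -
    have "runner y (Suc i) = {b. (b, Suc i) \<in> B}" if "i < e" for i
      using runner_conv_abacus[of "Suc i" y] that ylen y by simp
    moreover have "{1..e} = Suc ` {..<e}" by (simp add: lessThan_atLeast0 image_Suc_atLeastLessThan atLeastLessThanSuc_atLeastAtMost)
    ultimately show ?thesis by auto
  qed
  also have "\<dots> \<longleftrightarrow> (\<forall>j\<in>{1..l}. \<forall>\<beta>\<in>runner x j.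
       if j = l then \<beta> - int e \<in> runner x 1 else \<beta> \<in> runner x (j + 1))"
  proof -
    \<comment> \<open>Where the bead below goes in terms of the original runners.\<close>
    have step: "((int l * (q + 1) - int j + 1) - 1, i) \<in> B \<longleftrightarrow>
        (if j = l then q * int e + int i - int e \<in> runner x 1 else q * int e + int i \<in> runner x (j + 1))"
      if "1 \<le> i" "i \<le> e" "1 \<le> j" "j \<le> l" for q i j
    proof (cases "j = l")
      case True
      have "(int l * (q + 1) - int j + 1) - 1 = int l * ((q - 1) + 1) - int 1 + 1"
        using True by (simp add: algebra_simps)
      then show ?thesis using B[OF that(1,2), of 1 "q - 1"] l True by (simp add: algebra_simps)
    next
      case False
      have "(int l * (q + 1) - int j + 1) - 1 = int l * (q + 1) - int (j + 1) + 1" by simp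
      then show ?thesis using B[OF that(1,2), of "j + 1" q] that False by simp
    qed
    show ?thesis
    proof (intro iffI ballI allI impI)
      fix j \<beta> assume *: "\<forall>i\<in>{1..e}. \<forall>b. (b, i) \<in> B \<longrightarrow> (b - 1, i) \<in> B" and j: "j \<in> {1..l}" and \<beta>: "\<beta> \<in> runner x j"
      obtain q i where qi: "1 \<le> i" "i \<le> e" "\<beta> = q * int e + int i" using position_decomp[OF e] by blast
      show "if j = l then \<beta> - int e \<in> runner x 1 else \<beta> \<in> runner x (j + 1)"
      proof -
        have "(int l * (q + 1) - int j + 1, i) \<in> B" using B[OF qi(1,2), of j q] j \<beta> qi by simp
        then have "((int l * (q + 1) - int j + 1) - 1, i) \<in> B" using * qi by (meson atLeastAtMost_iff)
        then show ?thesis using step[OF qi(1,2), of j q] j qi by (auto split: if_splits)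
      qed
    next
      fix i b assume *: "\<forall>j\<in>{1..l}. \<forall>\<beta>\<in>runner x j.
           if j = l then \<beta> - int e \<in> runner x 1 else \<beta> \<in> runner x (j + 1)"
        and i: "i \<in> {1..e}" and b: "(b, i) \<in> B"
      obtain q j where qj: "1 \<le> j" "j \<le> l" "b = int l * (q + 1) - int j + 1"
        using level_rank_height_decomp[OF l] by blast
      show "(b - 1, i) \<in> B"
      proof -
        have "q * int e + int i \<in> runner x j" using B[of i j q] i b qj by simp
        then have "if j = l then q * int e + int i - int e \<in> runner x 1
            else q * int e + int i \<in> runner x (j + 1)"
          using * qj by (meson atLeastAtMost_iff)
        then show ?thesis using step[of i j q] i qj by simp
      qed
    qed
  qed
  finally show ?thesis using True by (simp add: es_core_def len x_def y_def)
qed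

section \<open>From cores to spetsial cores by shifting the charge\<close>

text \<open>
  The translation \<open>s \<mapsto> s - d \<rho>\<close> with \<open>\<rho> = (0, 1, \<dots>, l - 1)\<close>, which appears inside
  \<^const>\<open>charge_rank_tilde\<close>.
\<close>

definition charge_unshift :: "nat \<Rightarrow> int list \<Rightarrow> int list" where
  "charge_unshift d s = map (\<lambda>j. s ! j - int d * int j) [0..<length s]"

lemma length_charge_unshift [simp]: "length (charge_unshift d s) = length s"
  by (simp add: charge_unshift_def)

lemma charge_unshift_nth [simp]: "j < length s \<Longrightarrow> charge_unshift d s ! j = s ! j - int d * int j"
  by (simp add: charge_unshift_def)

lemma charge_unshift_surj: "\<exists>s. length s = length t \<and> charge_unshift d s = t"
  by (rule exI[of _ "map (\<lambda>j. t ! j + int d * int j) [0..<length t]"])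
     (auto intro!: nth_equalityI simp: charge_unshift_def)

lemma charge_unshift_inject:
  assumes "charge_unshift d s = charge_unshift d s'"
  shows "s = s'"
proof (rule nth_equalityI)
  show len: "length s = length s'" using assms length_charge_unshift by metis
  show "s ! j = s' ! j" if "j < length s" for j
    using that len charge_unshift_nth[of j s d] charge_unshift_nth[of j s' d] assms by simp
qed

lemma sum_list_charge_unshift:
  "sum_list (charge_unshift d s)
     = sum_list s - int d * (int (length s) * (int (length s) - 1) div 2)"
proof -
  have "(\<Sum>j<n. int j) = int n * (int n - 1) div 2" for n
    by (induction n) (auto simp: algebra_simps)
  then show ?thesis
    by (simp add: sum_list_sum_nth atLeast0LessThan sum_subtractf sum_distrib_left[symmetric])
qed

lemma runner_charge_unshift:
  assumes "1 \<le> j" "j \<le> length s"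
  shows "\<beta> \<in> runner (lam, charge_unshift d s) j \<longleftrightarrow> \<beta> + int d * (int j - 1) \<in> runner (lam, s) j"
proof -
  have "j - 1 < length s" using assms by auto
  then show ?thesis
    using assms beta_set_shift[of \<beta> "lam ! (j - 1)" "s ! (j - 1)" "- (int d * (int j - 1))"]
    by (simp add: runner_conv_beta_set of_nat_diff)
qed

text \<open>
  Raising runner \<open>j\<close> by \<open>d (j - 1)\<close> turns the spetsial condition, a shift by \<open>d\<close> between
  consecutive runners, into plain inclusions.  Going once around the cycle the shifts
  accumulate to \<open>d l\<close>, which is the \<open>e\<close> in the last inclusion of the chain.
\<close>

lemma es_core_iff_spetsial_core:
  assumes len: "length s = l" and l: "l \<ge> 1" and d: "d \<ge> 1"
  shows "es_core (d * l) s lam \<longleftrightarrow>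
           is_multipartition l lam \<and> spetsial_core d (lam, charge_unshift d s)"
proof -
  let ?R = "runner (lam, s)" and ?T = "runner (lam, charge_unshift d s)"
  have "(\<forall>\<beta>\<in>?R j. if j = l then \<beta> - int (d * l) \<in> ?R 1 else \<beta> \<in> ?R (j + 1))
      \<longleftrightarrow> (\<forall>\<beta>\<in>?T j. \<beta> - int d \<in> ?T (if j = l then 1 else j + 1))" if j: "j \<in> {1..l}" for j
  proof -
    have T: "\<beta> \<in> ?T j \<longleftrightarrow> \<beta> + int d * (int j - 1) \<in> ?R j"
      "\<beta> - int d \<in> ?T (if j = l then 1 else j + 1) \<longleftrightarrow>
         (if j = l then \<beta> + int d * (int j - 1) - int (d * l) \<in> ?R 1
          else \<beta> + int d * (int j - 1) \<in> ?R (j + 1))" for \<beta>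
      using runner_charge_unshift[of j s \<beta> lam d] runner_charge_unshift[of "j + 1" s "\<beta> - int d" lam d]
        runner_charge_unshift[of 1 s "\<beta> - int d" lam d] j len
      by (auto simp: algebra_simps)
    show ?thesis
    proof (intro iffI ballI)
      fix \<beta> assume *: "\<forall>\<beta>\<in>?R j. if j = l then \<beta> - int (d * l) \<in> ?R 1 else \<beta> \<in> ?R (j + 1)" 
        and "\<beta> \<in> ?T j"
      then show "\<beta> - int d \<in> ?T (if j = l then 1 else j + 1)" unfolding T by blast
    next
      fix \<beta> assume *: "\<forall>\<beta>\<in>?T j. \<beta> - int d \<in> ?T (if j = l then 1 else j + 1)" and \<beta>: "\<beta> \<in> ?R j"
      define \<gamma> where "\<gamma> = \<beta> - int d * (int j - 1)"
      have "\<beta> = \<gamma> + int d * (int j - 1)" by (simp add: \<gamma>_def)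
      then show "if j = l then \<beta> - int (d * l) \<in> ?R 1 else \<beta> \<in> ?R (j + 1)"
        using * \<beta> T[of \<gamma>] by metis
    qed
  qed
  moreover have "d * l \<ge> 1" using l d by simp
  ultimately show ?thesis
    unfolding es_core_iff_interlacing[OF len l \<open>d * l \<ge> 1\<close>] spetsial_core_def by (simp add: len Let_def)
qed

text \<open>
  Charges are monotone under inclusion of runners, so a charge admitting any core at all lies
  in the closed alcove.
\<close>

lemma es_core_imp_alcove:
  assumes len: "length s = l" and l: "l \<ge> 1" and e: "e \<ge> 1" and core: "es_core e s lam"
  shows "sorted s" "last s \<le> hd s + int e"
proof -
  have part: "is_partition (lam ! j)" if "j < l" for j
    using core that by (auto simp: es_core_def is_multipartition_def len)
  have chain: "if j = l then \<beta> - int e \<in> runner (lam, s) 1 else \<beta> \<in> runner (lam, s) (j + 1)"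
    if "j \<in> {1..l}" "\<beta> \<in> runner (lam, s) j" for j \<beta>
    using core that unfolding es_core_iff_interlacing[OF len l e] by blast
  have "s ! j \<le> s ! Suc j" if "Suc j < l" for j
  proof (rule beta_set_subset_imp_charge_le)
    show "beta_set (lam ! j) (s ! j) \<subseteq> beta_set (lam ! Suc j) (s ! Suc j)"
      using chain[of "Suc j"] that by (auto simp: runner_conv_beta_set)
  qed (use part that in auto)
  then show "sorted s" by (simp add: sorted_iff_nth_Suc len)
  have "s ! (l - 1) \<le> s ! 0 + int e"
  proof (rule beta_set_subset_imp_charge_le)
    show "beta_set (lam ! (l - 1)) (s ! (l - 1)) \<subseteq> beta_set (lam ! 0) (s ! 0 + int e)"
      using chain[of l] l by (auto simp: runner_conv_beta_set beta_set_shift)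
  qed (use part l in auto)
  then show "last s \<le> hd s + int e" using len l by (simp add: last_conv_nth hd_conv_nth flip: length_greater_0_conv)
qed

section \<open>Finiteness of charges and of multipartitions of bounded size\<close>

text \<open>
  The entries lie in a window of width \<open>e\<close> above the smallest one, and the fixed sum pins down
  where this window can be.
\<close>

lemma finite_alcove_charges:
  assumes l: "l \<ge> 1"
  shows "finite (alcove_charges l e S)"
proof (rule finite_subset)
  show "alcove_charges l e S \<subseteq> {s. set s \<subseteq> {- \<bar>S\<bar> - int e..\<bar>S\<bar> + int e} \<and> length s = l}"
  proof
    fix s assume "s \<in> alcove_charges l e S"
    then have s: "length s = l" "sorted s" "last s \<le> hd s + int e" "sum_list s = S"
      by (auto simp: alcove_charges_def)
    define a where "a = hd s"
    have lo: "a \<le> s ! j" and hi: "s ! j \<le> a + int e" if "j < l" for j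
    proof -
      have "s ! 0 \<le> s ! j" "s ! j \<le> s ! (l - 1)" using s that by (auto intro!: sorted_nth_mono)
      then show "a \<le> s ! j" "s ! j \<le> a + int e"
        using s l by (auto simp: a_def last_conv_nth hd_conv_nth simp flip: length_greater_0_conv)
    qed
    have S: "S = (\<Sum>j<l. s ! j)" using s by (simp add: sum_list_sum_nth atLeast0LessThan)
    have "int l * a \<le> S" "S \<le> int l * (a + int e)"
      using sum_mono[of "{..<l}" "\<lambda>_. a" "\<lambda>j. s ! j"] sum_mono[of "{..<l}" "\<lambda>j. s ! j" "\<lambda>_. a + int e"] lo hi S
      by auto
    have "a \<le> \<bar>S\<bar>"
    proof (cases "a \<ge> 0")
      case True
      then have "a \<le> int l * a" using l by (simp add: mult_le_cancel_right1)
      then show ?thesis using \<open>int l * a \<le> S\<close> by linarith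
    qed auto
    moreover have "- \<bar>S\<bar> - int e \<le> a"
    proof (cases "a + int e \<le> 0")
      case True
      then have "int l * (a + int e) \<le> 1 * (a + int e)" using l by (intro mult_right_mono_neg) auto
      then have "S \<le> a + int e" using \<open>S \<le> int l * (a + int e)\<close> by simp
      then show ?thesis by linarith
    qed auto
    ultimately have "- \<bar>S\<bar> - int e \<le> s ! j \<and> s ! j \<le> \<bar>S\<bar> + int e" if "j < l" for j
      using lo[OF that] hi[OF that] by linarith
    then show "s \<in> {s. set s \<subseteq> {- \<bar>S\<bar> - int e..\<bar>S\<bar> + int e} \<and> length s = l}"
      using s(1) by (auto simp: set_conv_nth)
  qed
qed (simp add: finite_lists_length_eq)

lemma partition_part_le_size: "is_partition p \<Longrightarrow> p i \<le> partition_size p"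
  unfolding partition_size_def is_partition_def by (cases "p i = 0") (auto intro: member_le_sum)

lemma partition_zero_beyond_size:
  assumes p: "is_partition p" and i: "partition_size p \<le> i"
  shows "p i = 0"
proof (rule ccontr)
  assume "p i \<noteq> 0"
  then have pos: "p k \<ge> 1" if "k \<le> i" for k using partition_antimono[OF p that] by linarith
  then have sub: "{..i} \<subseteq> {k. p k \<noteq> 0}" by force
  have "Suc i = (\<Sum>k\<le>i. 1)" by simp
  also have "\<dots> \<le> (\<Sum>k\<le>i. p k)" using pos by (intro sum_mono) auto
  also have "\<dots> \<le> partition_size p" unfolding partition_size_def
    using p sub by (intro sum_mono2) (auto simp: is_partition_def)
  finally show False using i by simp
qed

lemma finite_partitions_of_size_le: "finite {p. is_partition p \<and> partition_size p \<le> N}"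
proof (rule finite_subset)
  show "{p. is_partition p \<and> partition_size p \<le> N}
      \<subseteq> {p. \<forall>i. (i \<in> {..<N} \<longrightarrow> p i \<in> {..N}) \<and> (i \<notin> {..<N} \<longrightarrow> p i = 0)}"
  proof clarify
    fix p i assume p: "is_partition p" "partition_size p \<le> N"
    show "(i \<in> {..<N} \<longrightarrow> p i \<in> {..N}) \<and> (i \<notin> {..<N} \<longrightarrow> p i = 0)"
      using partition_part_le_size[OF p(1), of i] partition_zero_beyond_size[OF p(1), of i] p(2) by auto
  qed
  show "finite {p. \<forall>i. (i \<in> {..<N} \<longrightarrow> p i \<in> {..N}) \<and> (i \<notin> {..<N} \<longrightarrow> p i = (0::nat))}"
    by (rule finite_set_of_finite_funs) auto
qed

lemma finite_multipartitions_of_size_le: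
  "finite {lam. is_multipartition l lam \<and> int (multipartition_size lam) \<le> n}"
proof (rule finite_subset)
  show "{lam. is_multipartition l lam \<and> int (multipartition_size lam) \<le> n}
      \<subseteq> {lam. set lam \<subseteq> {p. is_partition p \<and> partition_size p \<le> nat n} \<and> length lam = l}"
  proof clarify
    fix lam assume lam: "is_multipartition l lam" "int (multipartition_size lam) \<le> n"
    have "partition_size p \<le> nat n" if "p \<in> set lam" for p
    proof -
      have "partition_size p \<le> multipartition_size lam"
        unfolding multipartition_size_def using that by (intro member_le_sum_list) auto
      then show ?thesis using lam by linarith
    qed
    then show "set lam \<subseteq> {p. is_partition p \<and> partition_size p \<le> nat n} \<and> length lam = l"
      using lam by (auto simp: is_multipartition_def)
  qed
qed (simp add: finite_lists_length_eq finite_partitions_of_size_le)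

section \<open>The generating function identity\<close>

lemma charge_rank_tilde_conv_unshift: "charge_rank_tilde d s = charge_rank (charge_unshift d s)"
  by (simp add: charge_rank_tilde_def charge_unshift_def)

text \<open>
  The partitions are left untouched and only the charge moves, so injectivity is clear.
  Every shifted charge that occurs lies in the alcove by monotonicity of charges, and
  its sum grows by \<open>d (0 + 1 + \<dots> + (l - 1))\<close>.
\<close>

lemma bij_betw_es_cores_spetsial_cores:
  fixes \<sigma> :: int
  assumes l: "l \<ge> 1" and d: "d \<ge> 1"
  defines "A \<equiv> alcove_charges l (d * l) (\<sigma> + int d * (int l * (int l - 1) div 2))"
  shows "bij_betw (\<lambda>(s, lam). (lam, charge_unshift d s))
           (SIGMA s:A. {lam. es_core (d * l) s lam}) (spetsial_cores l d \<sigma>)"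
  unfolding bij_betw_def
proof
  show "inj_on (\<lambda>(s, lam). (lam, charge_unshift d s)) (SIGMA s:A. {lam. es_core (d * l) s lam})"
    by (auto intro!: inj_onI dest: charge_unshift_inject)
  have e: "d * l \<ge> 1" using l d by simp
  show "(\<lambda>(s, lam). (lam, charge_unshift d s)) ` (SIGMA s:A. {lam. es_core (d * l) s lam})
      = spetsial_cores l d \<sigma>" (is "?f ` ?D = _")
  proof (intro set_eqI iffI)
    fix x assume "x \<in> ?f ` ?D"
    then obtain s lam where "x = (lam, charge_unshift d s)" "s \<in> A" "es_core (d * l) s lam" by auto
    then show "x \<in> spetsial_cores l d \<sigma>"
      using es_core_iff_spetsial_core[of s l d lam] l d
      by (auto simp: A_def alcove_charges_def spetsial_cores_def is_charged_multipartition_def sum_list_charge_unshift)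
  next
    fix x assume x: "x \<in> spetsial_cores l d \<sigma>"
    obtain lam t where xt: "x = (lam, t)" by fastforce
    have t: "is_multipartition l lam" "length t = l" "sum_list t = \<sigma>" "spetsial_core d (lam, t)"
      using x by (auto simp: xt spetsial_cores_def is_charged_multipartition_def)
    obtain s where s: "length s = l" "charge_unshift d s = t" using charge_unshift_surj[of t d] t(2) by auto
    have core: "es_core (d * l) s lam" using es_core_iff_spetsial_core[OF s(1) l d] t s by simp
    have "s \<in> A"
      using es_core_imp_alcove[OF s(1) l e core] sum_list_charge_unshift[of d s] s t
      by (simp add: A_def alcove_charges_def)
    then show "x \<in> ?f ` ?D" using core s xt by force
  qed
qed

lemma charged_rank_charge_unshift:
  assumes "length s = l" "l \<ge> 1" "is_multipartition l lam"
  shows "charged_rank (lam, charge_unshift d s)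
           = charge_rank_tilde d s + int (multipartition_size lam)"
  using charged_rank_eq_size_plus_charge_rank[OF assms(2,3), of "charge_unshift d s"] assms(1)
  by (simp add: charge_rank_tilde_conv_unshift)

theorem proposition5p3:
  fixes l d e :: nat and \<sigma> :: int
  assumes "l \<ge> 2" and "d \<ge> 1" and "e = d * l"
  defines "A \<equiv> alcove_charges l e (\<sigma> + int d * (int l * (int l - 1) div 2))"
  shows "(\<lambda>x. fls_X_intpow (charged_rank x) :: int fls) summable_on spetsial_cores l d \<sigma> \<and>
         finite A \<and>
         (\<forall>s\<in>A. (\<lambda>lam. fls_X_intpow (int (multipartition_size lam)) :: int fls)
                   summable_on {lam. es_core e s lam}) \<and>
         spetsial_gf l d \<sigma> =
           (\<Sum>s\<in>A. fls_X_intpow (charge_rank_tilde d s) * es_core_gf e s)"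
proof -
  define C where "C s = {lam. es_core e s lam}" for s
  have l: "l \<ge> 1" using assms(1) by simp
  define f where "f = (\<lambda>(s, lam :: (nat \<Rightarrow> nat) list). (lam, charge_unshift d s))"
  have bij: "bij_betw f (Sigma A C) (spetsial_cores l d \<sigma>)"
    using bij_betw_es_cores_spetsial_cores[OF l assms(2), of \<sigma>]
    unfolding A_def C_def assms(3) f_def .
  have finA: "finite A" unfolding A_def by (rule finite_alcove_charges[OF l])
  have lenA: "length s = l" if "s \<in> A" for s using that by (simp add: A_def alcove_charges_def)
  have finC: "finite {lam \<in> C s. int (multipartition_size lam) \<le> n}" if "s \<in> A" for s n
    by (rule finite_subset[OF _ finite_multipartitions_of_size_le[of l n]])
       (use lenA[OF that] in \<open>auto simp: C_def es_core_def\<close>)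
  have rank: "charged_rank (f (s, lam)) = charge_rank_tilde d s + int (multipartition_size lam)"
    if "s \<in> A" "lam \<in> C s" for s lam
    using charged_rank_charge_unshift[OF lenA[OF that(1)] l] that lenA[OF that(1)]
    by (simp add: f_def C_def es_core_def)
  \<comment> \<open>The bijection matches any condition on the weights; it is used both for sublevel sets and for fibres.\<close>
  have level: "bij_betw f (SIGMA s:A. {lam \<in> C s. P (charge_rank_tilde d s + int (multipartition_size lam))})
      {x \<in> spetsial_cores l d \<sigma>. P (charged_rank x)}" for P
  proof (rule bij_betw_subset[OF bij])
    show "f ` (SIGMA s:A. {lam \<in> C s. P (charge_rank_tilde d s + int (multipartition_size lam))})
        = {x \<in> spetsial_cores l d \<sigma>. P (charged_rank x)}"
      unfolding bij_betw_imp_surj_on[OF bij, symmetric] by (auto simp: rank intro!: imageI)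
  qed auto
  have finS: "finite {x \<in> spetsial_cores l d \<sigma>. charged_rank x \<le> n}" for n
  proof -
    have "finite (SIGMA s:A. {lam \<in> C s. charge_rank_tilde d s + int (multipartition_size lam) \<le> n})"
    proof (rule finite_SigmaI[OF finA])
      fix s assume "s \<in> A"
      then show "finite {lam \<in> C s. charge_rank_tilde d s + int (multipartition_size lam) \<le> n}"
        using finC[of s "n - charge_rank_tilde d s"] by (simp add: le_diff_eq add.commute)
    qed
    then show ?thesis using bij_betw_finite[OF level[of "\<lambda>r. r \<le> n"]] by simp
  qed
  have "spetsial_gf l d \<sigma> = (\<Sum>s\<in>A. fls_X_intpow (charge_rank_tilde d s) * es_core_gf e s)"
  proof (rule fls_eqI)
    fix n
    have eq: "{lam \<in> C s. charge_rank_tilde d s + int (multipartition_size lam) = n}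
        = {lam \<in> C s. int (multipartition_size lam) = n - charge_rank_tilde d s}" for s by auto
    have "spetsial_gf l d \<sigma> $$ n = int (card {x \<in> spetsial_cores l d \<sigma>. charged_rank x = n})"
      unfolding spetsial_gf_def by (rule infsum_fls_X_intpow_nth[OF finS])
    also have "\<dots> = int (card (SIGMA s:A.
        {lam \<in> C s. charge_rank_tilde d s + int (multipartition_size lam) = n}))"
      using bij_betw_same_card[OF level[of "\<lambda>r. r = n"]] by simp
    also have "\<dots> = (\<Sum>s\<in>A. int (card {lam \<in> C s. int (multipartition_size lam) = n - charge_rank_tilde d s}))"
    proof -
      have "finite {lam \<in> C s. int (multipartition_size lam) = n - charge_rank_tilde d s}" if "s \<in> A" for s
        by (rule finite_subset[OF _ finC[OF that, of "n - charge_rank_tilde d s"]]) auto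
      then show ?thesis unfolding eq using finA by simp
    qed
    also have "\<dots> = (\<Sum>s\<in>A. (fls_X_intpow (charge_rank_tilde d s) * es_core_gf e s) $$ n)"
    proof (rule sum.cong[OF refl])
      fix s assume "s \<in> A"
      then show "int (card {lam \<in> C s. int (multipartition_size lam) = n - charge_rank_tilde d s})
          = (fls_X_intpow (charge_rank_tilde d s) * es_core_gf e s) $$ n"
        using infsum_fls_X_intpow_nth[OF finC]
        by (simp add: es_core_gf_def C_def fls_X_intpow_times_conv_shift)
    qed
    finally show "spetsial_gf l d \<sigma> $$ n
        = (\<Sum>s\<in>A. fls_X_intpow (charge_rank_tilde d s) * es_core_gf e s) $$ n"
      by (simp add: fls_nth_sum)
  qed
  moreover have "(\<lambda>x. fls_X_intpow (charged_rank x) :: int fls) summable_on spetsial_cores l d \<sigma>"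
    using has_sum_fls_X_intpow[OF finS] by (auto simp: summable_on_def)
  moreover have "(\<lambda>lam. fls_X_intpow (int (multipartition_size lam)) :: int fls) summable_on C s"
    if "s \<in> A" for s
    using has_sum_fls_X_intpow[OF finC[OF that]] by (auto simp: summable_on_def)
  ultimately show ?thesis using finA by (simp add: C_def)
qed

end
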